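(* Let $A\in\mathbb{R}^{m\times n}$, $\mathbf{b}\in\mathbb{R}^m$, and $f(\mathbf{y})=\frac12\|A(\mathbf{y}\odot\mathbf{y})-\mathbf{b}\|^2$ for $\mathbf{y}\in\mathbb{R}^n$. Let $\mathbf{d}\in\mathcal{S}^{n-1}$ and let $\alpha,\lambda>0$ be constants. Let $\mathbf{z}=\mathbf{d}-\alpha\nabla f(\mathbf{d})=(z_1,\ldots,z_n)^T$, and define $\mathbf{v}=(v_1,\ldots,v_n)^T$ and $\mathbf{w}=(w_1,\ldots,w_n)^T$ by $$v_j=\begin{cases}1,&\text{if } z_j\ge 0,\\ -1,&\text{otherwise,}\end{cases}\qquad w_j=\lambda-\frac1\alpha|z_j|,\qquad j=1,\ldots,n.$$ Let $t\in\operatorname{argmin}_{j\in\{1,\ldots,n\}}w_j$ and $\mathbf{w}_-=\min(\mathbf{0},\mathbf{w})$ (entrywise minimum). Then the vector $$\overline{\mathbf{y}}=\begin{cases}(\underbrace{0,\ldots,0}_{t-1},v_t,\underbrace{0,\ldots,0}_{n-t})^T,&\text{if }\mathbf{w}\ge\mathbf{0},\\[2mm] -\dfrac{\mathbf{w}_-}{\|\mathbf{w}_-\|}\odot\mathbf{v},&\text{otherwise,}\end{cases}$$ is a global solution of the minimization problem $$\min_{\mathbf{y}\in\mathcal{S}^{n-1}}\ \langle\mathbf{y}-\mathbf{d},\nabla f(\mathbf{d})\rangle+\frac{1}{2\alpha}\|\mathbf{y}-\mathbf{d}\|^2+\lambda\|\mathbf{y}\|_1.$$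
   Context: $\mathcal{S}^{n-1}=\{\mathbf{y}\in\mathbb{R}^n : \mathbf{y}^T\mathbf{y}=1\}$ is the unit sphere; $\odot$ is the Hadamard (entrywise) product; $\|\cdot\|$ is the Euclidean norm; $\|\mathbf{y}\|_1=\sum_j|y_j|$; $\nabla f$ is the Euclidean gradient; vector inequalities are entrywise. *)

theory Defs
  imports "HOL-Analysis.Analysis"
begin

text \<open>On \<open>real ^ 'n\<close> the library's \<open>*\<close> is the entrywise (Hadamard) product
  and \<open>\<le>\<close> is the entrywise order.\<close>

text \<open>The gradient is unique where it exists; at a point where \<open>f\<close> is not
  differentiable the value is unspecified.\<close>

definition gradient :: "('a::real_inner \<Rightarrow> real) \<Rightarrow> 'a \<Rightarrow> 'a" where
  "gradient f x = (THE D. GDERIV f x :> D)"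

definition l1_norm :: "real ^ 'n \<Rightarrow> real" where
  "l1_norm y = (\<Sum>j\<in>UNIV. \<bar>y $ j\<bar>)"

text \<open>The order on \<open>real ^ 'n\<close> is not linear, so \<open>min 0 w\<close> on vectors
  would not be the entrywise minimum; it is therefore taken componentwise.\<close>

definition neg_part :: "real ^ 'n \<Rightarrow> real ^ 'n" where
  "neg_part w = (\<chi> j. min 0 (w $ j))"

definition hadamard_ls :: "real ^ 'n ^ 'm \<Rightarrow> real ^ 'm \<Rightarrow> real ^ 'n \<Rightarrow> real" where
  "hadamard_ls A b y = (1 / 2) * (norm (A *v (y * y) - b))\<^sup>2"

definition prox_objective ::
    "(real ^ 'n \<Rightarrow> real) \<Rightarrow> real ^ 'n \<Rightarrow> real \<Rightarrow> real \<Rightarrow> real ^ 'n \<Rightarrow> real" where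
  "prox_objective f d \<alpha> lam y =
     (y - d) \<bullet> gradient f d + 1 / (2 * \<alpha>) * (norm (y - d))\<^sup>2 + lam * l1_norm y"

end

theory Submission
  imports Defs
begin

text \<open>On the sphere all quadratic terms are constant, so up to a constant the objective is
  \<open>lam * l1_norm y - (y \<bullet> z) / \<alpha>\<close>. This is at least \<open>w \<bullet> \<bar>y\<bar>\<close>, with equality when each \<open>y $ j\<close>
  has the sign of \<open>z $ j\<close>. If \<open>w \<ge> 0\<close>, the bound \<open>l1_norm y \<ge> (norm y)\<^sup>2 = 1\<close> gives the minimum
  \<open>w $ t\<close>; otherwise the Cauchy-Schwarz inequality gives the minimum \<open>- norm (neg_part w)\<close>.\<close>

lemma norm_abs_vec: "norm \<bar>y\<bar> = norm (y :: real ^ 'n)"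
  by (simp add: norm_vec_def abs_vec_def)

lemma power2_norm_vec: "(norm (y :: real ^ 'n))\<^sup>2 = (\<Sum>j\<in>UNIV. (y $ j)\<^sup>2)"
  unfolding power2_norm_eq_inner by (simp add: inner_vec_def power2_eq_square)

text \<open>The entries of a unit vector lie in [-1, 1], where a square is at most the absolute
  value.\<close>

lemma l1_norm_ge_1:
  fixes y :: "real ^ 'n"
  assumes "norm y = 1"
  shows "1 \<le> l1_norm y"
proof -
  have "(y $ j)\<^sup>2 \<le> \<bar>y $ j\<bar>" for j
  proof -
    have "\<bar>y $ j\<bar> \<le> 1"
      using component_le_norm_cart[of y j] assms by simp
    then have "\<bar>y $ j\<bar> * \<bar>y $ j\<bar> \<le> \<bar>y $ j\<bar>"
      by (intro mult_left_le) auto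
    then show ?thesis
      by (simp add: power2_eq_square)
  qed
  then have "(norm y)\<^sup>2 \<le> l1_norm y"
    unfolding power2_norm_vec l1_norm_def by (intro sum_mono)
  then show ?thesis
    using assms by simp
qed

text \<open>Lowering every weight to the smallest one leaves \<open>w $ t * l1_norm y\<close>; since
  \<open>w $ t\<close> is nonnegative, \<open>l1_norm_ge_1\<close> can be multiplied by it.\<close>

lemma inner_abs_ge_component:
  fixes w y :: "real ^ 'n"
  assumes "norm y = 1" "0 \<le> w $ t" "\<And>j. w $ t \<le> w $ j"
  shows "w $ t \<le> w \<bullet> \<bar>y\<bar>"
proof -
  have "w $ t * 1 \<le> w $ t * l1_norm y"
    using assms(2) l1_norm_ge_1[OF assms(1)] by (intro mult_left_mono)
  also have "\<dots> = (\<Sum>j\<in>UNIV. w $ t * \<bar>y $ j\<bar>)"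
    by (simp add: l1_norm_def sum_distrib_left)
  also have "\<dots> \<le> w \<bullet> \<bar>y\<bar>"
    unfolding inner_vec_def
    by (intro sum_mono) (simp add: abs_vec_def assms(3) mult_right_mono)
  finally show ?thesis
    by simp
qed

text \<open>Since \<open>\<bar>y\<bar>\<close> is entrywise nonnegative, passing from
  \<open>w\<close> to \<open>neg_part w\<close> can only lower the inner product; Cauchy-Schwarz
  then applies with \<open>norm \<bar>y\<bar> = 1\<close>.\<close>

lemma inner_abs_ge_norm_neg_part:
  fixes w y :: "real ^ 'n"
  assumes "norm y = 1"
  shows "- norm (neg_part w) \<le> w \<bullet> \<bar>y\<bar>"
proof -
  have "- norm (neg_part w) \<le> neg_part w \<bullet> \<bar>y\<bar>"
    using Cauchy_Schwarz_ineq2[of "neg_part w" "\<bar>y\<bar>"] assms by (simp add: norm_abs_vec abs_le_iff)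
  also have "\<dots> \<le> w \<bullet> \<bar>y\<bar>"
    unfolding inner_vec_def neg_part_def
    by (intro sum_mono) (simp add: abs_vec_def mult_right_mono)
  finally show ?thesis .
qed

text \<open>Positive entries of \<open>w\<close> meet zeros of \<open>neg_part w\<close>. This
  evaluates the candidate when \<open>w\<close> has a negative entry.\<close>

lemma inner_neg_part: "w \<bullet> neg_part w = (norm (neg_part w))\<^sup>2"
  unfolding power2_norm_vec inner_vec_def
  by (intro sum.cong) (auto simp: neg_part_def min_def power2_eq_square)

text \<open>For unit vectors the squared distance is \<open>2 - 2 * (y \<bullet> d)\<close>, so the
  proximal term becomes linear in \<open>y\<close> and merges with the gradient term.\<close>

lemma prox_objective_sphere:
  fixes d y :: "real ^ 'n"
  assumes "norm d = 1" "norm y = 1" "\<alpha> > 0"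
  shows "prox_objective f d \<alpha> lam y =
    1 / \<alpha> - d \<bullet> gradient f d + (lam * l1_norm y - y \<bullet> (d - \<alpha> *\<^sub>R gradient f d) / \<alpha>)"
proof -
  have "d \<bullet> d = 1" "y \<bullet> y = 1"
    using assms by (simp_all add: norm_eq_1)
  then have "(norm (y - d))\<^sup>2 = 2 - 2 * (y \<bullet> d)"
    by (simp add: power2_norm_eq_inner inner_diff inner_commute)
  then have "1 / (2 * \<alpha>) * (norm (y - d))\<^sup>2 = 1 / \<alpha> - y \<bullet> d / \<alpha>"
    by (simp add: diff_divide_distrib)
  then show ?thesis
    using assms(3) by (simp add: prox_objective_def inner_diff diff_divide_distrib)
qed

lemma l1_norm_minus_inner:
  fixes y z :: "real ^ 'n"
  shows "lam * l1_norm y - y \<bullet> z / \<alpha> = (\<Sum>j\<in>UNIV. lam * \<bar>y $ j\<bar> - y $ j * z $ j / \<alpha>)"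
  by (simp add: l1_norm_def inner_vec_def sum_distrib_left sum_divide_distrib sum_subtractf)

text \<open>Termwise, a product is at most its absolute value, and dividing by
  \<open>\<alpha> > 0\<close> keeps the order.\<close>

lemma inner_abs_le_l1_norm_minus_inner:
  fixes y z :: "real ^ 'n"
  assumes "\<alpha> > 0"
  shows "(\<chi> j. lam - 1 / \<alpha> * \<bar>z $ j\<bar>) \<bullet> \<bar>y\<bar> \<le> lam * l1_norm y - y \<bullet> z / \<alpha>"
proof -
  have "(lam - 1 / \<alpha> * \<bar>z $ j\<bar>) * \<bar>y $ j\<bar> \<le> lam * \<bar>y $ j\<bar> - y $ j * z $ j / \<alpha>" for j
  proof -
    have "y $ j * z $ j / \<alpha> \<le> \<bar>y $ j\<bar> * \<bar>z $ j\<bar> / \<alpha>"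
      using assms abs_ge_self[of "y $ j * z $ j"] by (simp add: abs_mult divide_right_mono)
    then show ?thesis
      by (simp add: algebra_simps)
  qed
  then show ?thesis
    unfolding l1_norm_minus_inner by (simp add: inner_vec_def abs_vec_def sum_mono)
qed

text \<open>The equality case of the preceding bound: no entry of \<open>y\<close> has the sign
  opposite to that of \<open>z\<close>.\<close>

lemma inner_abs_eq_l1_norm_minus_inner:
  fixes y z :: "real ^ 'n"
  assumes "\<And>j. y $ j * z $ j = \<bar>y $ j\<bar> * \<bar>z $ j\<bar>"
  shows "(\<chi> j. lam - 1 / \<alpha> * \<bar>z $ j\<bar>) \<bullet> \<bar>y\<bar> = lam * l1_norm y - y \<bullet> z / \<alpha>"
  unfolding l1_norm_minus_inner
  by (simp add: inner_vec_def abs_vec_def assms algebra_simps)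

theorem theorem3p2:
  fixes A :: "real ^ 'n ^ 'm" and b :: "real ^ 'm"
    and f :: "real ^ 'n \<Rightarrow> real"
    and d z v w ybar :: "real ^ 'n"
    and \<alpha> lam :: real and t :: 'n
  assumes f_eq: "f = hadamard_ls A b"
    and d_sphere: "d \<in> sphere 0 1"
    and alpha_pos: "\<alpha> > 0"
    and lam_pos: "lam > 0"
    and z_eq: "z = d - \<alpha> *\<^sub>R gradient f d"
    and v_eq: "v = (\<chi> j. if z $ j \<ge> 0 then 1 else - 1)"
    and w_eq: "w = (\<chi> j. lam - 1 / \<alpha> * \<bar>z $ j\<bar>)"
    and t_argmin: "is_arg_min (\<lambda>j. w $ j) (\<lambda>j. j \<in> UNIV) t"
    and ybar_eq: "ybar =
      (if w \<ge> 0 then (\<chi> j. if j = t then v $ t else 0)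
       else (- (1 / norm (neg_part w)) *\<^sub>R neg_part w) * v)"
  shows "is_arg_min (prox_objective f d \<alpha> lam) (\<lambda>y. y \<in> sphere 0 1) ybar"
proof -
  have norm_d: "norm d = 1"
    using d_sphere by simp
  \<comment> \<open>Taking \<open>v $ j = 1\<close> at \<open>z $ j = 0\<close>, where
    \<open>sgn\<close> would give 0, makes the first claim hold for every \<open>j\<close>.\<close>
  have abs_v: "\<bar>v $ j\<bar> = 1" and v_z: "v $ j * z $ j = \<bar>z $ j\<bar>" for j
    by (simp_all add: v_eq)
  have t_le: "w $ t \<le> w $ j" for j
    using t_argmin by (auto simp: is_arg_min_linorder)
  \<comment> \<open>Both cases supply the same three facts: feasibility, sign agreement with
    \<open>z\<close>, and minimality for the reduced objective.\<close>
  have "norm ybar = 1 \<and> (\<forall>j. ybar $ j * z $ j = \<bar>ybar $ j\<bar> * \<bar>z $ j\<bar>) \<and>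
    (\<forall>y. norm y = 1 \<longrightarrow> w \<bullet> \<bar>ybar\<bar> \<le> w \<bullet> \<bar>y\<bar>)"
  proof (cases "w \<ge> 0")
    case True
    then have ybar: "ybar = axis t (v $ t)"
      by (simp add: ybar_eq axis_def)
    have abs_ybar: "\<bar>ybar\<bar> = axis t 1"
      by (simp add: ybar abs_vec_def axis_def vec_eq_iff abs_v)
    have "w $ t \<ge> 0"
      using True by (simp add: less_eq_vec_def)
    then have "w $ t \<le> w \<bullet> \<bar>y\<bar>" if "norm y = 1" for y
      using that t_le by (intro inner_abs_ge_component)
    moreover have "norm ybar = 1"
      using norm_abs_vec[of ybar] by (simp add: abs_ybar norm_axis_1)
    moreover have "ybar $ j * z $ j = \<bar>ybar $ j\<bar> * \<bar>z $ j\<bar>" for j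
      by (simp add: ybar axis_def abs_v v_z)
    ultimately show ?thesis
      by (simp add: abs_ybar inner_axis)
  next
    case False
    let ?n = "norm (neg_part w)"
    obtain j where "w $ j < 0"
      using False by (auto simp: less_eq_vec_def not_le)
    then have "neg_part w $ j \<noteq> 0"
      by (simp add: neg_part_def)
    then have "neg_part w \<noteq> 0"
      by (metis zero_index)
    then have n_pos: "?n > 0"
      by simp
    have ybar: "ybar $ j = - (neg_part w $ j / ?n) * v $ j" for j
      using False by (simp add: ybar_eq)
    \<comment> \<open>The leading minus sign makes the factor of \<open>v $ j\<close> nonnegative,
      so \<open>v\<close> alone carries the sign and \<open>\<bar>ybar\<bar>\<close> points along
      \<open>- neg_part w\<close>, the direction of equality in Cauchy-Schwarz.\<close>
    have "neg_part w $ j / ?n \<le> 0" for j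
      using n_pos by (intro divide_nonpos_pos) (simp_all add: neg_part_def)
    then have abs_j: "\<bar>ybar $ j\<bar> = - (neg_part w $ j / ?n)" for j
      unfolding ybar abs_mult abs_v abs_minus_cancel mult_1_right by (rule abs_of_nonpos)
    have abs_ybar: "\<bar>ybar\<bar> = - (1 / ?n) *\<^sub>R neg_part w"
      by (simp add: abs_vec_def vec_eq_iff abs_j)
    have "norm ybar = norm \<bar>ybar\<bar>"
      by (simp add: norm_abs_vec)
    also have "\<dots> = 1"
      using n_pos by (simp add: abs_ybar)
    finally have "norm ybar = 1" .
    moreover have "ybar $ j * z $ j = \<bar>ybar $ j\<bar> * \<bar>z $ j\<bar>" for j
      unfolding abs_j by (simp add: ybar v_z[symmetric])
    moreover have "w \<bullet> \<bar>ybar\<bar> = - ?n"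
      using n_pos by (simp add: abs_ybar inner_neg_part power2_eq_square)
    ultimately show ?thesis
      by (simp add: inner_abs_ge_norm_neg_part)
  qed
  then have norm_ybar: "norm ybar = 1"
    and sign: "\<And>j. ybar $ j * z $ j = \<bar>ybar $ j\<bar> * \<bar>z $ j\<bar>"
    and min: "\<And>y. norm y = 1 \<Longrightarrow> w \<bullet> \<bar>ybar\<bar> \<le> w \<bullet> \<bar>y\<bar>"
    by auto
  have "prox_objective f d \<alpha> lam ybar \<le> prox_objective f d \<alpha> lam y" if "norm y = 1" for y
  proof -
    \<comment> \<open>The reduction to \<open>w\<close> is exact at \<open>ybar\<close> and only a
      lower bound at \<open>y\<close>, which is the direction needed.\<close>
    have "lam * l1_norm ybar - ybar \<bullet> z / \<alpha> = w \<bullet> \<bar>ybar\<bar>"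
      unfolding w_eq by (rule inner_abs_eq_l1_norm_minus_inner[OF sign, symmetric])
    also have "\<dots> \<le> w \<bullet> \<bar>y\<bar>"
      by (rule min[OF that])
    also have "\<dots> \<le> lam * l1_norm y - y \<bullet> z / \<alpha>"
      unfolding w_eq by (rule inner_abs_le_l1_norm_minus_inner[OF alpha_pos])
    finally show ?thesis
      using norm_d norm_ybar that alpha_pos
      by (simp add: prox_objective_sphere z_eq)
  qed
  then show ?thesis
    using norm_ybar by (simp add: is_arg_min_linorder)
qed

end
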